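(* Let $\epsilon\in(0,1)$. Any algorithm (adaptive or non-adaptive, possibly with two-sided error) which receives query access to the entries of a matrix $\mathbf{A}\in\mathbb{R}^{n\times n}$ with $\|\mathbf{A}\|_\infty\le 1$ and distinguishes with probability at least $2/3$ whether (1) $\mathbf{A}$ is positive semidefinite, or (2) $x^\top\mathbf{A}x<-\epsilon n$ for some unit vector $x\in\mathbb{R}^n$, must make $\Omega(1/\epsilon^2)$ queries to $\mathbf{A}$.
   Context: $\|\mathbf{A}\|_\infty=\max_{i,j}|\mathbf{A}_{i,j}|$. A query reveals one entry $\mathbf{A}_{i,j}$.
   Formalization: The bound, with one absolute constant, is stated for n ≥ 1/ε; without such a condition it fails, since reading all n² entries always suffices (for n = 1 a single query is enough however small ε is). *)

theory Defs
  imports "HOL-Probability.Probability_Measure" "Jordan_Normal_Form.Matrix"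
begin

no_notation inner (infix "\<bullet>" 70)

section \<open>Matrices\<close>

definition max_entry_norm :: "real mat \<Rightarrow> real" where
  "max_entry_norm A = Max {\<bar>A $$ (i, j)\<bar> | i j. i < dim_row A \<and> j < dim_col A}"

definition input_matrices :: "nat \<Rightarrow> real mat set" where
  "input_matrices n = {A \<in> carrier_mat n n. max_entry_norm A \<le> 1}"

text \<open>Symmetry is part of positive semidefiniteness. Dropping it would oblige a tester to accept
  more matrices, so a lower bound for this notion also covers the variant without symmetry.\<close>

definition psd_mat :: "nat \<Rightarrow> real mat \<Rightarrow> bool" where
  "psd_mat n A \<longleftrightarrow> A \<in> carrier_mat n n \<and> transpose_mat A = A \<and>
     (\<forall>x \<in> carrier_vec n. x \<bullet> (A *\<^sub>v x) \<ge> 0)"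

definition unit_vector :: "nat \<Rightarrow> real vec \<Rightarrow> bool" where
  "unit_vector n x \<longleftrightarrow> x \<in> carrier_vec n \<and> sqrt (x \<bullet> x) = 1"

definition far_from_psd :: "nat \<Rightarrow> real \<Rightarrow> real mat \<Rightarrow> bool" where
  "far_from_psd n \<epsilon> A \<longleftrightarrow> (\<exists>x. unit_vector n x \<and> x \<bullet> (A *\<^sub>v x) < - \<epsilon> * real n)"

section \<open>Query algorithms\<close>

text \<open>A deterministic adaptive algorithm is a decision tree: it either stops with an answer, or
  queries the entry \<open>(i, j)\<close> and continues with a tree depending on the real number revealed.
  Non-adaptive algorithms are the trees whose queried positions ignore the revealed values.
  The answer \<open>True\<close> stands for ``positive semidefinite''.\<close>

datatype query_tree = Answer bool | Query nat nat "real \<Rightarrow> query_tree"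

primrec answer :: "real mat \<Rightarrow> query_tree \<Rightarrow> bool" where
  "answer A (Answer b) = b"
| "answer A (Query i j next_step) = answer A (next_step (A $$ (i, j)))"

primrec num_queries :: "real mat \<Rightarrow> query_tree \<Rightarrow> nat" where
  "num_queries A (Answer b) = 0"
| "num_queries A (Query i j next_step) = Suc (num_queries A (next_step (A $$ (i, j))))"

primrec queries_in_range :: "nat \<Rightarrow> query_tree \<Rightarrow> bool" where
  "queries_in_range n (Answer b) = True"
| "queries_in_range n (Query i j next_step) =
     (i < n \<and> j < n \<and> (\<forall>r. queries_in_range n (next_step r)))"

text \<open>A randomized algorithm is a probability distribution over decision trees. The
  \<open>\<sigma>\<close>-algebra is arbitrary, so every probability space of random seeds is covered by pushing it
  forward along the map from seeds to trees.\<close>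

definition randomized_algorithm :: "nat \<Rightarrow> query_tree measure \<Rightarrow> bool" where
  "randomized_algorithm n M \<longleftrightarrow> prob_space M \<and> (\<forall>t \<in> space M. queries_in_range n t)"

text \<open>Two-sided error. A non-measurable set has \<^const>\<open>measure\<close> 0, so both inequalities include
  measurability of the event in question. Inputs satisfying neither case are unconstrained.\<close>

definition distinguishes_psd :: "nat \<Rightarrow> real \<Rightarrow> query_tree measure \<Rightarrow> bool" where
  "distinguishes_psd n \<epsilon> M \<longleftrightarrow>
     (\<forall>A \<in> input_matrices n.
        (psd_mat n A \<longrightarrow> measure M {t \<in> space M. answer A t} \<ge> 2 / 3) \<and>
        (far_from_psd n \<epsilon> A \<longrightarrow> measure M {t \<in> space M. \<not> answer A t} \<ge> 2 / 3))"

definition makes_at_most_queries :: "nat \<Rightarrow> nat \<Rightarrow> query_tree measure \<Rightarrow> bool" where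
  "makes_at_most_queries n q M \<longleftrightarrow>
     (\<forall>A \<in> input_matrices n. AE t in M. num_queries A t \<le> q)"

end

(*
  No tester can find a planted negative block in the zero matrix. Cut the index set into 2h
  consecutive blocks of length m, where m is slightly larger than \<epsilon> n, and call the first h blocks
  left and the others right. For a left block U and a right block V let B(U, V) be -1 on
  U \<times> V \<union> V \<times> U and 0 elsewhere; the normalized indicator of U \<union> V gives the value -m < -\<epsilon> n.
  The supports of these h^2 far matrices are pairwise disjoint, so on the all-zero path a decision
  tree with q queries can tell at most q of them from the zero matrix, which is positive
  semidefinite. Averaging over the randomness, each far matrix is told from 0 with probability at
  least 1/3, so q \<ge> h^2 / 3.
*)

theory Submission
  imports Defs
begin

lemma input_matricesI:
  assumes "n > 0" "A \<in> carrier_mat n n"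
    and "\<And>i j. i < n \<Longrightarrow> j < n \<Longrightarrow> \<bar>A $$ (i, j)\<bar> \<le> 1"
  shows "A \<in> input_matrices n"
proof -
  let ?E = "{\<bar>A $$ (i, j)\<bar> | i j. i < dim_row A \<and> j < dim_col A}"
  have eq: "?E = (\<lambda>(i, j). \<bar>A $$ (i, j)\<bar>) ` ({..<n} \<times> {..<n})"
    using assms(2) by auto
  have "finite ?E" "?E \<noteq> {}"
    unfolding eq using assms(1) by auto
  moreover have "\<forall>e \<in> ?E. e \<le> 1"
    using assms(2,3) by auto
  ultimately show ?thesis
    using assms(2) by (simp add: input_matrices_def max_entry_norm_def)
qed

lemma psd_zero_mat: "psd_mat n (0\<^sub>m n n)"
  by (auto simp: psd_mat_def scalar_prod_def)

text \<open>The witness is the normalized indicator vector of \<open>S\<close>.\<close>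

lemma far_from_psdI_block:
  assumes A: "A \<in> carrier_mat n n" and S: "S \<subseteq> {0..<n}" "S \<noteq> {}"
    and neg: "(\<Sum>i\<in>S. \<Sum>j\<in>S. A $$ (i, j)) < - \<epsilon> * real n * real (card S)"
  shows "far_from_psd n \<epsilon> A"
proof -
  define d where "d = 1 / sqrt (card S)"
  define x where "x = vec n (\<lambda>i. if i \<in> S then d else 0)"
  have fin: "finite S" using S(1) finite_subset by blast
  then have card: "real (card S) > 0" using S(2) by (simp add: card_gt_0_iff)
  have dd: "d * d = 1 / card S"
    using card by (simp add: d_def)
  have restrict: "(\<Sum>i\<in>{0..<n}. if i \<in> S then f i else 0) = sum f S" for f :: "nat \<Rightarrow> real"
    using S(1) by (simp add: sum.If_cases Int_absorb1)
  have "x \<bullet> x = (\<Sum>i\<in>{0..<n}. if i \<in> S then d * d else 0)"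
    unfolding scalar_prod_def by (auto simp: x_def intro!: sum.cong)
  also have "\<dots> = 1"
    using card by (simp only: restrict) (simp add: dd)
  finally have unit: "unit_vector n x"
    by (simp add: unit_vector_def x_def)
  have row: "(A *\<^sub>v x) $ i = d * (\<Sum>j\<in>S. A $$ (i, j))" if "i < n" for i
  proof -
    have "(A *\<^sub>v x) $ i = (\<Sum>j\<in>{0..<n}. if j \<in> S then d * A $$ (i, j) else 0)"
      using A that by (auto simp: x_def scalar_prod_def intro!: sum.cong)
    then show ?thesis
      by (simp only: restrict sum_distrib_left)
  qed
  have "x \<bullet> (A *\<^sub>v x) =
      (\<Sum>i\<in>{0..<n}. if i \<in> S then d * d * (\<Sum>j\<in>S. A $$ (i, j)) else 0)"
    using A row unfolding scalar_prod_def by (auto simp: x_def intro!: sum.cong)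
  also have "\<dots> = (\<Sum>i\<in>S. \<Sum>j\<in>S. A $$ (i, j)) / card S"
    by (simp only: restrict dd flip: sum_distrib_left) simp
  also have "\<dots> < - \<epsilon> * real n"
    using neg card by (simp add: pos_divide_less_eq)
  finally show ?thesis
    using unit by (auto simp: far_from_psd_def)
qed

lemma card_told_apart_le_num_queries:
  assumes "finite P" "queries_in_range n t"
    and disj: "\<And>i j. i < n \<Longrightarrow> j < n \<Longrightarrow> card {p \<in> P. F p $$ (i, j) \<noteq> A $$ (i, j)} \<le> 1"
  shows "card {p \<in> P. answer (F p) t \<noteq> answer A t} \<le> num_queries A t"
  using assms(2)
proof (induction t)
  case (Answer b)
  then show ?case by simp
next
  case (Query i j nxt)
  let ?t = "nxt (A $$ (i, j))"
  let ?X = "{p \<in> P. F p $$ (i, j) \<noteq> A $$ (i, j)}"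
  let ?Y = "{p \<in> P. answer (F p) ?t \<noteq> answer A ?t}"
  have "card {p \<in> P. answer (F p) (Query i j nxt) \<noteq> answer A (Query i j nxt)} \<le> card (?X \<union> ?Y)"
    using \<open>finite P\<close> by (intro card_mono) auto
  also have "\<dots> \<le> card ?X + card ?Y"
    by (rule card_Un_le)
  also have "\<dots> \<le> 1 + num_queries A ?t"
    using Query disj by (intro add_mono) auto
  finally show ?case by simp
qed

lemma queries_lower_bound:
  assumes M: "randomized_algorithm n M" "distinguishes_psd n \<epsilon> M" "makes_at_most_queries n q M"
    and A: "A \<in> input_matrices n" "psd_mat n A"
    and F: "\<And>p. p \<in> P \<Longrightarrow> F p \<in> input_matrices n" "\<And>p. p \<in> P \<Longrightarrow> far_from_psd n \<epsilon> (F p)"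
    and "finite P"
    and disj: "\<And>i j. i < n \<Longrightarrow> j < n \<Longrightarrow> card {p \<in> P. F p $$ (i, j) \<noteq> A $$ (i, j)} \<le> 1"
  shows "real (card P) / 3 \<le> real q"
proof -
  interpret prob_space M
    using M(1) by (simp add: randomized_algorithm_def)
  define Y where "Y = {t \<in> space M. answer A t}"
  define N where "N p = {t \<in> space M. \<not> answer (F p) t}" for p
  have Y: "prob Y \<ge> 2 / 3"
    using M(2) A by (simp add: distinguishes_psd_def Y_def)
  then have Y_meas: "Y \<in> events"
    using measure_notin_sets[of Y M] by fastforce
  have N: "prob (N p) \<ge> 2 / 3" if "p \<in> P" for p
    using M(2) F that by (simp add: distinguishes_psd_def N_def)
  then have N_meas: "N p \<in> events" if "p \<in> P" for p
    using measure_notin_sets[of "N p" M] that by fastforce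
  have both: "prob (Y \<inter> N p) \<ge> 1 / 3" if "p \<in> P" for p
  proof -
    have "prob (Y \<union> N p) = prob Y + prob (N p) - prob (Y \<inter> N p)"
      using Y_meas N_meas[OF that]
      by (simp add: finite_measure_Union' finite_measure_Diff' Int_commute)
    then show ?thesis
      using Y N[OF that] prob_le_1[of "Y \<union> N p"] by linarith
  qed
  have "real (card P) / 3 \<le> (\<Sum>p\<in>P. prob (Y \<inter> N p))"
    using sum_mono[of P "\<lambda>_. 1 / 3" "\<lambda>p. prob (Y \<inter> N p)"] both by simp
  also have "\<dots> = expectation (\<lambda>t. \<Sum>p\<in>P. indicator (Y \<inter> N p) t)"
    using Y_meas N_meas by (subst Bochner_Integration.integral_sum)
      (auto intro!: integrable_real_indicator simp: emeasure_eq_measure)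
  also have "\<dots> \<le> expectation (\<lambda>_. real q)"
  proof (rule integral_mono_AE)
    show "integrable M (\<lambda>t. \<Sum>p\<in>P. indicator (Y \<inter> N p) t :: real)"
      using Y_meas N_meas
      by (auto intro!: Bochner_Integration.integrable_sum integrable_real_indicator
          simp: emeasure_eq_measure)
    have "AE t in M. num_queries A t \<le> q"
      using M(3) A(1) by (simp add: makes_at_most_queries_def)
    then show "AE t in M. (\<Sum>p\<in>P. indicator (Y \<inter> N p) t) \<le> real q"
    proof (rule AE_mp, intro AE_I2 impI)
      fix t assume t: "t \<in> space M" "num_queries A t \<le> q"
      have "(\<Sum>p\<in>P. indicator (Y \<inter> N p) t :: real) = card {p \<in> P. t \<in> Y \<inter> N p}"
        using \<open>finite P\<close> by (simp add: indicator_def sum.If_cases Int_def)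
      also have "card {p \<in> P. t \<in> Y \<inter> N p} \<le> card {p \<in> P. answer (F p) t \<noteq> answer A t}"
        using \<open>finite P\<close> by (intro card_mono) (auto simp: Y_def N_def)
      also have "\<dots> \<le> num_queries A t"
        using t(1) M(1) \<open>finite P\<close> disj
        by (intro card_told_apart_le_num_queries) (auto simp: randomized_algorithm_def)
      also note t(2)
      finally show "(\<Sum>p\<in>P. indicator (Y \<inter> N p) t) \<le> real q"
        by simp
    qed
  qed simp
  finally show ?thesis by (simp add: prob_space)
qed

definition cross_block :: "nat \<Rightarrow> nat set \<Rightarrow> nat set \<Rightarrow> real mat" where
  "cross_block n U V =
     mat n n (\<lambda>(i, j). if i \<in> U \<and> j \<in> V \<or> i \<in> V \<and> j \<in> U then -1 else 0)"

lemma cross_block_input: "n > 0 \<Longrightarrow> cross_block n U V \<in> input_matrices n"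
  by (rule input_matricesI) (auto simp: cross_block_def)

lemma cross_block_far:
  assumes U: "U \<subseteq> {0..<n}" "card U = m" and V: "V \<subseteq> {0..<n}" "card V = m"
    and "U \<inter> V = {}" and m: "m > 0" "\<epsilon> * real n < real m"
  shows "far_from_psd n \<epsilon> (cross_block n U V)"
proof (rule far_from_psdI_block)
  have fin: "finite U" "finite V" using U V finite_subset by blast+
  have "(\<Sum>j\<in>U \<union> V. cross_block n U V $$ (i, j)) = - real m" if "i \<in> U \<union> V" for i
  proof -
    have "cross_block n U V $$ (i, j) =
        (if i \<in> U then if j \<in> V then -1 else 0 else if j \<in> U then -1 else 0)"
      if "j \<in> U \<union> V" for j
    proof -
      have "i < n" "j < n" using that \<open>i \<in> U \<union> V\<close> U(1) V(1) by auto
      then show ?thesis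
        using that \<open>i \<in> U \<union> V\<close> \<open>U \<inter> V = {}\<close> by (auto simp: cross_block_def)
    qed
    then have "(\<Sum>j\<in>U \<union> V. cross_block n U V $$ (i, j)) =
        (\<Sum>j\<in>U \<union> V. if i \<in> U then if j \<in> V then -1 else 0 else if j \<in> U then -1 else 0)"
      by (intro sum.cong) auto
    also have "\<dots> = - real m"
      using fin U(2) V(2) by (auto simp: sum.If_cases Int_absorb1)
    finally show ?thesis .
  qed
  then have "(\<Sum>i\<in>U \<union> V. \<Sum>j\<in>U \<union> V. cross_block n U V $$ (i, j)) = - real m * card (U \<union> V)"
    by simp
  also have "\<dots> < - (\<epsilon> * real n) * card (U \<union> V)"
    using m U(2) fin by (intro mult_strict_right_mono) (auto simp: card_gt_0_iff)
  finally show "(\<Sum>i\<in>U \<union> V. \<Sum>j\<in>U \<union> V. cross_block n U V $$ (i, j)) <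
      - \<epsilon> * real n * real (card (U \<union> V))"
    by simp
  show "U \<union> V \<noteq> {}" using U m by auto
qed (use U V in \<open>auto simp: cross_block_def\<close>)

lemma queries_ge_third:
  assumes M: "randomized_algorithm n M" "distinguishes_psd n \<epsilon> M" "makes_at_most_queries n q M"
    and "n > 0" "\<epsilon> < 1"
  shows "1 / 3 \<le> real q"
proof -
  define J where "J = mat n n (\<lambda>_. -1 :: real)"
  have "J \<in> input_matrices n"
    using \<open>n > 0\<close> by (intro input_matricesI) (auto simp: J_def)
  moreover have "far_from_psd n \<epsilon> J"
    using \<open>n > 0\<close> \<open>\<epsilon> < 1\<close>
    by (intro far_from_psdI_block[where S = "{0..<n}"]) (auto simp: J_def)
  moreover have "0\<^sub>m n n \<in> input_matrices n"
    using \<open>n > 0\<close> by (intro input_matricesI) auto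
  ultimately show ?thesis
    using queries_lower_bound[OF M _ psd_zero_mat, of "{()}" "\<lambda>_. J"]
      card_mono[of "{()}"] by simp
qed

lemma queries_ge_num_blocks:
  assumes M: "randomized_algorithm n M" "distinguishes_psd n \<epsilon> M" "makes_at_most_queries n q M"
    and n: "n > 0" and m: "m > 0" "\<epsilon> * real n < real m" and h: "2 * h * m \<le> n"
  shows "(real h)\<^sup>2 / 3 \<le> real q"
proof -
  define B where "B a = {i. i div m = a}" for a
  define F where "F = (\<lambda>(a, b). cross_block n (B a) (B (h + b)))"
  let ?P = "{..<h} \<times> {..<h}"
  have B_eq: "B a = {a * m..<Suc a * m}" for a
    using m(1) by (auto simp: B_def div_nat_eqI mult.commute dividend_less_times_div
        intro: less_le_trans)
  have B_card: "card (B a) = m" for a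
    by (simp add: B_eq)
  have B_sub: "B a \<subseteq> {0..<n}" if "a < 2 * h" for a
  proof -
    have "Suc a * m \<le> 2 * h * m" using that by (intro mult_right_mono) auto
    then show ?thesis using h by (auto simp: B_eq)
  qed
  have disj: "card {p \<in> ?P. F p $$ (i, j) \<noteq> 0\<^sub>m n n $$ (i, j)} \<le> 1" if "i < n" "j < n" for i j
  proof -
    have "{p \<in> ?P. F p $$ (i, j) \<noteq> 0\<^sub>m n n $$ (i, j)} \<subseteq>
        {(min (i div m) (j div m), max (i div m) (j div m) - h)}"
      using that by (auto simp: F_def cross_block_def B_def split: if_splits)
    from card_mono[OF _ this] show ?thesis by simp
  qed
  have "far_from_psd n \<epsilon> (F p)" if p: "p \<in> ?P" for p
  proof -
    obtain a b where ab: "p = (a, b)" "a < h" "b < h" using p by auto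
    have "far_from_psd n \<epsilon> (cross_block n (B a) (B (h + b)))"
      using ab m B_card by (intro cross_block_far[where m = m] B_sub) (auto simp: B_def)
    then show ?thesis by (simp add: F_def ab)
  qed
  moreover have "F p \<in> input_matrices n" for p
    using n by (auto simp: F_def cross_block_input split: prod.split)
  moreover have "0\<^sub>m n n \<in> input_matrices n"
    using n by (intro input_matricesI) auto
  ultimately have "real (card ?P) / 3 \<le> real q"
    using disj by (intro queries_lower_bound[OF M _ psd_zero_mat, where F = F]) auto
  then show ?thesis by (simp add: power2_eq_square)
qed

lemma exists_block_partition:
  fixes \<epsilon> :: real
  assumes "0 < \<epsilon>" "\<epsilon> \<le> 1 / 8" "real n \<ge> 1 / \<epsilon>"
  obtains m h :: nat where "m > 0" "\<epsilon> * real n < real m" "2 * h * m \<le> n" "1 / (8 * \<epsilon>) \<le> real h"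
proof
  define m where "m = nat \<lfloor>\<epsilon> * real n\<rfloor> + 1"
  define h where "h = n div (2 * m)"
  have en: "\<epsilon> * real n \<ge> 1"
    using assms by (simp add: field_simps)
  show m: "m > 0" "\<epsilon> * real n < real m"
    using en unfolding m_def by (simp, linarith)
  show "2 * h * m \<le> n"
    using div_times_less_eq_dividend[of n "2 * m"] by (simp add: h_def algebra_simps)
  have m_le: "real m \<le> 2 * (\<epsilon> * real n)"
    using en unfolding m_def by linarith
  have "n < 2 * m * Suc h"
    using m(1) dividend_less_times_div[of "2 * m" n] by (simp add: h_def)
  then have "real n < real (2 * m * Suc h)"
    by (simp only: of_nat_less_iff)
  also have "\<dots> = real m * (2 * (real h + 1))"
    by (simp add: algebra_simps)
  also have "\<dots> \<le> 2 * (\<epsilon> * real n) * (2 * (real h + 1))"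
    using m_le by (intro mult_right_mono) auto
  also have "\<dots> = real n * (4 * \<epsilon> * (real h + 1))"
    by simp
  finally have "1 < 4 * \<epsilon> * (real h + 1)"
    using mult_less_cancel_left[of "real n" 1] by (simp add: zero_less_mult_iff)
  then show "1 / (8 * \<epsilon>) \<le> real h"
    using assms(1,2) by (simp add: field_simps)
qed

theorem mainTheorem2:
  shows "\<exists>c::real. c > 0 \<and>
    (\<forall>(\<epsilon>::real) (n::nat) (q::nat) (M :: query_tree measure).
       0 < \<epsilon> \<longrightarrow> \<epsilon> < 1 \<longrightarrow> real n \<ge> 1 / \<epsilon> \<longrightarrow>
       randomized_algorithm n M \<longrightarrow>
       distinguishes_psd n \<epsilon> M \<longrightarrow>
       makes_at_most_queries n q M \<longrightarrow>
       real q \<ge> c * (1 / \<epsilon>\<^sup>2))"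
proof (rule exI[of _ "1 / 192"], intro conjI allI impI)
  fix \<epsilon> :: real and n q :: nat and M :: "query_tree measure"
  assume \<epsilon>: "0 < \<epsilon>" "\<epsilon> < 1" and n: "real n \<ge> 1 / \<epsilon>"
    and M: "randomized_algorithm n M" "distinguishes_psd n \<epsilon> M" "makes_at_most_queries n q M"
  have "0 < 1 / \<epsilon>" using \<epsilon> by simp
  then have n0: "n > 0" using n by (cases n) auto
  show "1 / 192 * (1 / \<epsilon>\<^sup>2) \<le> real q"
  proof (cases "\<epsilon> \<le> 1 / 8")
    case True
    obtain m h where mh: "m > 0" "\<epsilon> * real n < real m" "2 * h * m \<le> n" "1 / (8 * \<epsilon>) \<le> real h"
      using exists_block_partition[OF \<epsilon>(1) True n] .
    have "1 / 192 * (1 / \<epsilon>\<^sup>2) = (1 / (8 * \<epsilon>))\<^sup>2 / 3"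
      by (simp add: power2_eq_square)
    also have "\<dots> \<le> (real h)\<^sup>2 / 3"
      using mh(4) \<epsilon> by (intro divide_right_mono power_mono) auto
    also have "\<dots> \<le> real q"
      using queries_ge_num_blocks[OF M n0 mh(1-3)] .
    finally show ?thesis .
  next
    case False
    then have "(1 / 8)\<^sup>2 \<le> \<epsilon>\<^sup>2"
      by (intro power_mono) auto
    then have "1 / 192 * (1 / \<epsilon>\<^sup>2) \<le> 1 / 3"
      using \<epsilon> by (simp add: field_simps power2_eq_square)
    also have "\<dots> \<le> real q"
      using queries_ge_third[OF M n0 \<epsilon>(2)] .
    finally show ?thesis .
  qed
qed simp

end
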